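(* Let $t\ge 1$ be an integer and let $K_t$ be the complete graph on $t$ vertices. If $\Gamma$ is a finite simple graph with $A(\Gamma;x)=A(K_t;x)$, then $\Gamma$ is isomorphic to $K_t$.
   Context: All graphs are finite and simple with at least one vertex. For a graph $\Gamma=(V,E)$ of order $n$, a vertex $v$ and $X\subseteq V$, let $\delta_X(v)$ be the number of neighbours of $v$ in $X$, $\delta_1$ the maximum degree, and $\bar S=V\setminus S$. Let $\mathcal{K}=[-\delta_1,\delta_1]\cap\mathbb{Z}$. A nonempty $S\subseteq V$ is a defensive $k$-alliance if $\delta_S(v)\ge\delta_{\bar S}(v)+k$ for all $v\in S$. The exact index of alliance of a nonempty $S$ is $k_S=\max\{k\in\mathcal{K}: S \text{ is a defensive } k\text{-alliance}\}$ (equivalently $k_S=\min_{v\in S}(\delta_S(v)-\delta_{\bar S}(v))$). The alliance polynomial is $A(\Gamma;x)=\sum_{S} x^{n+k_S}$, the sum over all nonempty $S\subseteq V$ whose induced subgraph $\langle S\rangle$ is connected. *)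

theory Defs
  imports
    "HOL-Computational_Algebra.Polynomial"
    "Graph_Theory.Digraph_Component"
    "Graph_Theory.Digraph_Isomorphism"
    "Graph_Theory.Kuratowski"
begin

text \<open>
  A finite simple graph is a \<^locale>\<open>graph\<close> of \<open>Graph_Theory\<close>: a finite, loop-free, symmetric digraph
  without parallel arcs, in which an undirected edge is a pair of opposite arcs.
\<close>

definition nbr_count :: "('a, 'b) pre_digraph \<Rightarrow> 'a set \<Rightarrow> 'a \<Rightarrow> nat" where
  "nbr_count G X v = card {u \<in> X. v \<rightarrow>\<^bsub>G\<^esub> u}"

definition max_degree :: "('a, 'b) pre_digraph \<Rightarrow> nat" where
  "max_degree G = Max (nbr_count G (verts G) ` verts G)"

definition defensive_alliance :: "('a, 'b) pre_digraph \<Rightarrow> int \<Rightarrow> 'a set \<Rightarrow> bool" where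
  "defensive_alliance G k S \<longleftrightarrow> S \<noteq> {} \<and> S \<subseteq> verts G \<and>
     (\<forall>v\<in>S. int (nbr_count G S v) \<ge> int (nbr_count G (verts G - S) v) + k)"

definition exact_index :: "('a, 'b) pre_digraph \<Rightarrow> 'a set \<Rightarrow> int" where
  "exact_index G S =
     Max {k \<in> {- int (max_degree G)..int (max_degree G)}. defensive_alliance G k S}"

text \<open>
  The exponent \<open>n + k\<^sub>S\<close> is positive because \<open>k\<^sub>S \<ge> - \<delta>\<^sub>1\<close> and \<open>\<delta>\<^sub>1 < n\<close>, so \<^const>\<open>nat\<close> does not truncate
  (see \<open>order_plus_exact_index_pos\<close> below).
\<close>

definition alliance_poly :: "('a, 'b) pre_digraph \<Rightarrow> int poly" where
  "alliance_poly G =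
     (\<Sum>S | S \<noteq> {} \<and> S \<subseteq> verts G \<and> Digraph_Component.connected (G \<restriction> S).
        monom 1 (nat (int (card (verts G)) + exact_index G S)))"

context graph
begin

lemma nbr_count_le_max_degree:
  assumes "X \<subseteq> verts G" "v \<in> verts G"
  shows "nbr_count G X v \<le> max_degree G"
proof -
  have "nbr_count G X v \<le> nbr_count G (verts G) v"
    unfolding nbr_count_def using assms by (intro card_mono) auto
  also have "\<dots> \<le> max_degree G"
    unfolding max_degree_def using assms by (intro Max_ge) auto
  finally show ?thesis .
qed

lemma max_degree_less_order:
  assumes "verts G \<noteq> {}"
  shows "max_degree G < card (verts G)"
proof -
  have "nbr_count G (verts G) v < card (verts G)" if "v \<in> verts G" for v
  proof -
    have "{u \<in> verts G. v \<rightarrow>\<^bsub>G\<^esub> u} \<subset> verts G"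
      using that adj_not_same by blast
    then show ?thesis unfolding nbr_count_def by (simp add: psubset_card_mono)
  qed
  then show ?thesis unfolding max_degree_def using assms by simp
qed

lemma exact_index_eq_Min:
  assumes "S \<noteq> {}" "S \<subseteq> verts G"
  shows "exact_index G S = Min ((\<lambda>v. int (nbr_count G S v) - int (nbr_count G (verts G - S) v)) ` S)"
    (is "_ = Min (?d ` S)")
    and "- int (max_degree G) \<le> exact_index G S"
proof -
  have fin: "finite S" using assms finite_subset finite_verts by blast
  have bound: "- int (max_degree G) \<le> ?d v" "?d v \<le> int (max_degree G)" if "v \<in> S" for v
    using nbr_count_le_max_degree[of S v] nbr_count_le_max_degree[of "verts G - S" v] assms that
    by auto
  have "Min (?d ` S) \<in> ?d ` S" using fin assms by (intro Min_in) auto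
  then have range: "Min (?d ` S) \<in> {- int (max_degree G)..int (max_degree G)}"
    using bound by fastforce
  have iff: "defensive_alliance G k S \<longleftrightarrow> k \<le> Min (?d ` S)" for k
    using assms fin by (subst Min_ge_iff) (auto simp: defensive_alliance_def algebra_simps)
  have "finite {k \<in> {- int (max_degree G)..int (max_degree G)}. k \<le> Min (?d ` S)}"
    by (rule finite_subset[of _ "{- int (max_degree G)..int (max_degree G)}"]) auto
  then show eq: "exact_index G S = Min (?d ` S)"
    unfolding exact_index_def iff using range by (intro Max_eqI) auto
  show "- int (max_degree G) \<le> exact_index G S"
    using range eq by simp
qed

lemma order_plus_exact_index_pos:
  assumes "S \<noteq> {}" "S \<subseteq> verts G"
  shows "0 < int (card (verts G)) + exact_index G S"
proof -
  have "verts G \<noteq> {}" using assms by auto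
  then show ?thesis using exact_index_eq_Min(2)[OF assms] max_degree_less_order by linarith
qed

end

end

theory Submission
  imports Defs
begin

text \<open>
  The exponent \<open>n + k\<^sub>S\<close> is \<open>1\<close> exactly when \<open>S = {v}\<close> with \<open>v\<close> of degree \<open>n - 1\<close>, so the coefficient
  of \<open>x\<close> counts such universal vertices, while the value at \<open>1\<close> counts the connected vertex sets. If
  \<open>A(\<Gamma>; x) = A(K\<^sub>t; x)\<close>, then \<open>\<Gamma>\<close> has exactly \<open>t\<close> universal vertices, and every vertex set meeting
  them is connected. This gives at least \<open>2\<^sup>n - 2\<^sup>n\<^sup>-\<^sup>t = (2\<^sup>t - 1) 2\<^sup>n\<^sup>-\<^sup>t\<close> connected sets, but there
  are at most \<open>2\<^sup>t - 1\<close>, so \<open>n = t\<close> and all vertices are universal.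
\<close>

definition universal_verts :: "('a, 'b) pre_digraph \<Rightarrow> 'a set" where
  "universal_verts G = {v \<in> verts G. \<forall>u \<in> verts G - {v}. v \<rightarrow>\<^bsub>G\<^esub> u}"

definition connected_verts :: "('a, 'b) pre_digraph \<Rightarrow> 'a set set" where
  "connected_verts G =
     {S. S \<noteq> {} \<and> S \<subseteq> verts G \<and> Digraph_Component.connected (G \<restriction> S)}"

lemma (in fin_digraph) finite_connected_verts: "finite (connected_verts G)"
  by (rule finite_subset[of _ "Pow (verts G)"]) (auto simp: connected_verts_def)

lemma poly_alliance_poly_1: "poly (alliance_poly G) 1 = int (card (connected_verts G))"
  by (simp add: alliance_poly_def connected_verts_def poly_sum poly_monom)

text \<open>The arcs from \<open>v\<close> to the other vertices of \<open>S\<close> form a spanning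
  star of the induced subgraph, so any two vertices of \<open>S\<close> are joined through
  \<open>v\<close> in the symmetric closure.\<close>

lemma (in wf_digraph) connected_induce_subgraph_universal:
  assumes "S \<subseteq> verts G" "v \<in> S" "v \<in> universal_verts G"
  shows "Digraph_Component.connected (G \<restriction> S)"
proof -
  let ?r = "rtrancl_on S (symcl (arcs_ends (G \<restriction> S)))"
  have arc: "(v, u) \<in> arcs_ends (G \<restriction> S)" if "u \<in> S" "u \<noteq> v" for u
  proof -
    from assms that have "v \<rightarrow>\<^bsub>G\<^esub> u" by (auto simp: universal_verts_def)
    then show ?thesis using assms that by (auto simp: arcs_ends_conv)
  qed
  have "(v, u) \<in> ?r \<and> (u, v) \<in> ?r" if "u \<in> S" for u
    using arc[OF that] that assms(2)
    by (cases "u = v") (auto simp: symcl_def intro: rtrancl_on_into_rtrancl_on[OF rtrancl_on_refl])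
  then show ?thesis
    using assms(2) unfolding connected_conv by (auto intro: rtrancl_on_trans)
qed

context graph
begin

text \<open>If v attains the minimum that defines k_S, then n + k_S = |S| + (|V - S| - d_out(v)) +
  d_in(v), where d_in and d_out count the neighbours of v inside and outside S. All three terms are
  nonnegative and the first is at least 1, so the value 1 forces S = {v} and makes v adjacent to
  everything outside S.\<close>

lemma order_plus_exact_index_eq_1_iff:
  assumes "S \<noteq> {}" "S \<subseteq> verts G"
  shows "int (card (verts G)) + exact_index G S = 1 \<longleftrightarrow> (\<exists>v \<in> universal_verts G. S = {v})"
proof
  let ?d = "\<lambda>v. int (nbr_count G S v) - int (nbr_count G (verts G - S) v)"
  have fin: "finite S" using finite_subset[OF assms(2)] by simp
  assume eq: "int (card (verts G)) + exact_index G S = 1"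
  have "exact_index G S \<in> ?d ` S"
    unfolding exact_index_eq_Min(1)[OF assms] using fin assms by (intro Min_in) auto
  then obtain v where v: "v \<in> S" and d: "exact_index G S = ?d v" by auto
  have out: "nbr_count G (verts G - S) v \<le> card (verts G - S)"
    unfolding nbr_count_def by (intro card_mono) auto
  have card: "card (verts G - S) + card S = card (verts G)"
    using assms fin by (simp add: card_Diff_subset card_mono)
  have "0 < card S" using fin assms by (simp add: card_gt_0_iff)
  then have "card S = 1" and full: "nbr_count G (verts G - S) v = card (verts G - S)"
    using eq d out card by linarith+
  then have S: "S = {v}" using v by (auto simp: card_1_singleton_iff)
  have "{u \<in> verts G - S. v \<rightarrow>\<^bsub>G\<^esub> u} = verts G - S"
    using full unfolding nbr_count_def by (intro card_subset_eq) auto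
  then have "v \<in> universal_verts G"
    using S assms by (auto simp: universal_verts_def)
  then show "\<exists>v \<in> universal_verts G. S = {v}" using S by blast
next
  assume "\<exists>v \<in> universal_verts G. S = {v}"
  then obtain v where v: "v \<in> universal_verts G" and S: "S = {v}" by blast
  have "{u \<in> verts G - {v}. v \<rightarrow>\<^bsub>G\<^esub> u} = verts G - {v}" and "{u \<in> {v}. v \<rightarrow>\<^bsub>G\<^esub> u} = {}"
    using v adj_not_same by (auto simp: universal_verts_def)
  then have "nbr_count G (verts G - S) v = card (verts G - {v})" and "nbr_count G S v = 0"
    unfolding S nbr_count_def by simp_all
  moreover have "card (verts G - {v}) + 1 = card (verts G)"
    using v by (simp add: universal_verts_def card_Suc_Diff1 del: card_Diff_insert)
  ultimately show "int (card (verts G)) + exact_index G S = 1"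
    using exact_index_eq_Min(1)[OF assms] by (simp add: S)
qed

lemma coeff_alliance_poly_1: "coeff (alliance_poly G) 1 = int (card (universal_verts G))"
proof -
  let ?e = "\<lambda>S. nat (int (card (verts G)) + exact_index G S)"
  have "coeff (alliance_poly G) 1 = (\<Sum>S \<in> connected_verts G. if ?e S = 1 then 1 else 0)"
    by (simp add: alliance_poly_def connected_verts_def coeff_sum)
  also have "\<dots> = int (card {S \<in> connected_verts G. ?e S = 1})"
    using finite_connected_verts by (simp add: sum.If_cases Int_def)
  also have "{S \<in> connected_verts G. ?e S = 1} = (\<lambda>v. {v}) ` universal_verts G"
  proof -
    \<comment> \<open>Truncation by \<open>nat\<close> does no harm: \<open>nat x = 1\<close> holds
      only for x = 1.\<close>
    have "?e S = 1 \<longleftrightarrow> (\<exists>v \<in> universal_verts G. S = {v})" if "S \<in> connected_verts G" for S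
      using order_plus_exact_index_eq_1_iff[of S] that by (auto simp: connected_verts_def)
    moreover have "{v} \<in> connected_verts G" if "v \<in> universal_verts G" for v
      using connected_induce_subgraph_universal[of "{v}" v] that
      by (auto simp: connected_verts_def universal_verts_def)
    ultimately show ?thesis by blast
  qed
  also have "card \<dots> = card (universal_verts G)"
    by (simp add: card_image)
  finally show ?thesis .
qed

lemma card_connected_verts_le: "card (connected_verts G) \<le> 2 ^ card (verts G) - 1"
proof -
  have "card (connected_verts G) \<le> card (Pow (verts G) - {{}})"
    by (intro card_mono) (auto simp: connected_verts_def)
  then show ?thesis by (simp add: card_Pow)
qed

lemma card_connected_verts_ge:
  "2 ^ card (verts G) - 2 ^ (card (verts G) - card (universal_verts G))
     \<le> card (connected_verts G)"
proof -
  have U: "universal_verts G \<subseteq> verts G" by (auto simp: universal_verts_def)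
  then have "finite (universal_verts G)" by (rule finite_subset) simp
  then have "2 ^ card (verts G) - 2 ^ (card (verts G) - card (universal_verts G))
      = card (Pow (verts G)) - card (Pow (verts G - universal_verts G))"
    using U by (simp add: card_Pow card_Diff_subset)
  \<comment> \<open>This difference consists of the sets that meet \<open>universal_verts G\<close>;
    the empty set is removed with the sets that avoid it.\<close>
  also have "\<dots> = card (Pow (verts G) - Pow (verts G - universal_verts G))"
    by (intro card_Diff_subset[symmetric]) auto
  also have "\<dots> \<le> card (connected_verts G)"
    using finite_connected_verts connected_induce_subgraph_universal
    by (intro card_mono) (auto simp: connected_verts_def)
  finally show ?thesis .
qed

text \<open>Bridge between the counting and \<open>complete_digraph\<close>: it supplies the t
  universal vertices of \<open>K\<close> and, at the end, the completeness of
  \<open>G\<close>.\<close>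

lemma complete_digraph_iff_universal:
  "complete_digraph (card (verts G)) G \<longleftrightarrow> universal_verts G = verts G"
proof
  assume "complete_digraph (card (verts G)) G"
  then show "universal_verts G = verts G"
    by (auto simp: complete_digraph_def universal_verts_def)
next
  assume U: "universal_verts G = verts G"
  have "u \<rightarrow>\<^bsub>G\<^esub> v" if "u \<in> verts G" "v \<in> verts G" "u \<noteq> v" for u v
  proof -
    from that U have "u \<in> universal_verts G" by simp
    with that show ?thesis by (simp add: universal_verts_def)
  qed
  then have "arcs_ends G = {(u, v). (u, v) \<in> verts G \<times> verts G \<and> u \<noteq> v}"
    using adj_not_same adj_in_verts by blast
  then show "complete_digraph (card (verts G)) G"
    unfolding complete_digraph_def using graph_axioms by simp
qed

end

text \<open>Any bijection of the vertices maps off-diagonal pairs onto off-diagonal pairs. Without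
  parallel arcs an arc is determined by its ordered pair of ends, so the bijection lifts to the
  arcs.\<close>

lemma complete_digraph_iso:
  assumes G: "complete_digraph n G" and H: "complete_digraph n H"
  shows "digraph_iso G H"
proof -
  interpret G: graph G using G by (simp add: complete_digraph_def)
  interpret H: graph H using H by (simp add: complete_digraph_def)
  have GE: "arcs_ends G = {(u, v). u \<in> verts G \<and> v \<in> verts G \<and> u \<noteq> v}"
    and HE: "arcs_ends H = {(u, v). u \<in> verts H \<and> v \<in> verts H \<and> u \<noteq> v}"
    using G H by (auto simp: complete_digraph_def)
  obtain f where f: "bij_betw f (verts G) (verts H)"
    using finite_same_card_bij[of "verts G" "verts H"] G H by (auto simp: complete_digraph_def)
  have bijG: "bij_betw (arc_to_ends G) (arcs G) (arcs_ends G)"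
    using G.no_multi_arcs by (auto simp: bij_betw_def inj_on_def arcs_ends_def)
  have bijH: "bij_betw (arc_to_ends H) (arcs H) (arcs_ends H)"
    using H.no_multi_arcs by (auto simp: bij_betw_def inj_on_def arcs_ends_def)
  have bijE: "bij_betw (map_prod f f) (arcs_ends G) (arcs_ends H)"
    unfolding bij_betw_def
  proof
    show "inj_on (map_prod f f) (arcs_ends G)"
      using f by (auto simp: GE inj_on_def bij_betw_def)
    have img: "f ` verts G = verts H" and inj: "inj_on f (verts G)"
      using f by (auto simp: bij_betw_def)
    show "map_prod f f ` arcs_ends G = arcs_ends H"
    proof
      show "map_prod f f ` arcs_ends G \<subseteq> arcs_ends H"
        using img inj by (auto simp: GE HE inj_on_eq_iff)
      show "arcs_ends H \<subseteq> map_prod f f ` arcs_ends G"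
        by (force simp: GE HE simp flip: img)
    qed
  qed
  define g where "g = the_inv_into (arcs H) (arc_to_ends H) \<circ> map_prod f f \<circ> arc_to_ends G"
  have g: "bij_betw g (arcs G) (arcs H)"
    unfolding g_def using bijG bijE bij_betw_the_inv_into[OF bijH] by (intro bij_betw_trans)
  have g_ends: "arc_to_ends H (g a) = map_prod f f (arc_to_ends G a)" if "a \<in> arcs G" for a
  proof -
    have "map_prod f f (arc_to_ends G a) \<in> arcs_ends H"
      using bijE that by (auto simp: bij_betw_def arcs_ends_def)
    then show ?thesis using bijH
      unfolding g_def bij_betw_def by (simp add: f_the_inv_into_f)
  qed
  \<comment> \<open>Taking \<open>head H\<close> and \<open>tail H\<close> themselves makes
    \<open>app_iso ?h G\<close> equal to \<open>H\<close> as a record, even on values that are not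
    arcs of \<open>H\<close>.\<close>
  let ?h = "\<lparr>iso_verts = f, iso_arcs = g, iso_head = head H, iso_tail = tail H\<rparr>"
  have "G.digraph_isomorphism ?h"
    using f g g_ends G.wf_digraph
    by (auto simp: G.digraph_isomorphism_def bij_betw_def arc_to_ends_def)
  moreover have "H = app_iso ?h G"
    using f g by (intro pre_digraph.equality) (auto simp: bij_betw_def)
  ultimately show ?thesis unfolding digraph_iso_def by blast
qed

theorem theorem3p9:
  fixes t :: nat
    and K :: "('c, 'd) pre_digraph"
    and G :: "('a, 'b) pre_digraph"
  assumes "t \<ge> 1"
    and "complete_digraph t K"
    and "graph G"
    and "verts G \<noteq> {}"
    and "alliance_poly G = alliance_poly K"
  shows "digraph_iso G K"
proof -
  interpret G: graph G by fact
  interpret K: graph K using assms(2) by (simp add: complete_digraph_def)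
  let ?n = "card (verts G)"
  have t: "card (verts K) = t" using assms(2) by (simp add: complete_digraph_def)
  have "card (universal_verts K) = t"
    using K.complete_digraph_iff_universal assms(2) t by simp
  then have u: "card (universal_verts G) = t"
    using assms(5) G.coeff_alliance_poly_1 K.coeff_alliance_poly_1 by simp
  have sub: "universal_verts G \<subseteq> verts G" by (auto simp: universal_verts_def)
  then have le: "t \<le> ?n" using u card_mono[OF G.finite_verts] by blast
  have "card (connected_verts G) = card (connected_verts K)"
    using assms(5) poly_alliance_poly_1[of G] poly_alliance_poly_1[of K] by simp
  then have "2 ^ ?n - 2 ^ (?n - t) \<le> (2 ^ t - 1 :: nat)"
    using G.card_connected_verts_ge K.card_connected_verts_le u t by simp
  moreover have "(2 ^ ?n - 2 ^ (?n - t) :: nat) = (2 ^ t - 1) * 2 ^ (?n - t)"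
    using le by (simp add: diff_mult_distrib flip: power_add)
  \<comment> \<open>Here t \<ge> 1 enters: the common factor is positive and cancels, which leaves
    2^(n - t) \<le> 1.\<close>
  moreover have "(2 ^ t - 1 :: nat) > 0" using \<open>t \<ge> 1\<close> one_less_power[of "2 :: nat" t] by simp
  ultimately have "(2 :: nat) ^ (?n - t) \<le> 1" by simp
  then have "?n = t" using le one_less_power[of "2 :: nat" "?n - t"] by (cases "?n = t") auto
  then have "universal_verts G = verts G"
    using sub u by (intro card_subset_eq) auto
  then have "complete_digraph t G"
    using G.complete_digraph_iff_universal \<open>?n = t\<close> by simp
  then show ?thesis using assms(2) by (rule complete_digraph_iso)
qed

end
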